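(* Let $\gamma>0$ and let $X_1,X_2,\ldots$ be independent exponential random variables with mean $1$. For $n\ge1$ let $$M_n=\max_{i=1,\ldots,n}\{i^\gamma X_i\},\qquad \tau_n=\min\{i=1,\ldots,n: i^\gamma X_i=M_n\}.$$ Then $$\Big(\frac{M_n}{n^\gamma}-\beta_n,\ \frac{n-\tau_n}{n}\log n\Big)\ \longrightarrow\ (G,E_\gamma)\quad\text{in distribution as }n\to\infty,$$ where $\beta_n=\log(n/\gamma)-\log\log(n)$ and $G,E_\gamma$ are independent random variables: $G$ is Gumbel and $E_\gamma$ is exponential with rate $\gamma$.
   Context: The Gumbel distribution has distribution function $\mathbb P(G\le x)=\exp(-e^{-x})$, $x\in\mathbb R$. *)

theory Defs
  imports "HOL-Probability.Probability"
begin

text \<open>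
  \<^const>\<open>weak_conv_m\<close> only covers laws on the real line.  The version below is for random
  variables with values in an arbitrary topological space and uses bounded continuous test functions;
  the limit may live on a different probability space.  Measurability is part of the definition
  because the Bochner integral of a non-measurable function is 0.
\<close>

definition converges_in_distribution ::
  "'a measure \<Rightarrow> (nat \<Rightarrow> 'a \<Rightarrow> 'c::topological_space) \<Rightarrow> 'b measure \<Rightarrow> ('b \<Rightarrow> 'c) \<Rightarrow> bool" where
  "converges_in_distribution M Y N Z \<longleftrightarrow>
     (\<forall>n. Y n \<in> borel_measurable M) \<and> Z \<in> borel_measurable N \<and>
     (\<forall>f :: 'c \<Rightarrow> real. continuous_on UNIV f \<and> bounded (range f) \<longrightarrow>
        (\<lambda>n. \<integral>\<omega>. f (Y n \<omega>) \<partial>M) \<longlonglongrightarrow> (\<integral>\<omega>. f (Z \<omega>) \<partial>N))"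

definition gumbel_distributed :: "'b measure \<Rightarrow> ('b \<Rightarrow> real) \<Rightarrow> bool" where
  "gumbel_distributed N G \<longleftrightarrow>
     G \<in> borel_measurable N \<and> (\<forall>x. cdf (distr N borel G) x = exp (- exp (- x)))"

definition weighted_max :: "real \<Rightarrow> (nat \<Rightarrow> 'a \<Rightarrow> real) \<Rightarrow> nat \<Rightarrow> 'a \<Rightarrow> real" where
  "weighted_max \<gamma> X n \<omega> = Max ((\<lambda>i. real i powr \<gamma> * X i \<omega>) ` {1..n})"

definition weighted_argmax :: "real \<Rightarrow> (nat \<Rightarrow> 'a \<Rightarrow> real) \<Rightarrow> nat \<Rightarrow> 'a \<Rightarrow> nat" where
  "weighted_argmax \<gamma> X n \<omega> =
     Min {i \<in> {1..n}. real i powr \<gamma> * X i \<omega> = weighted_max \<gamma> X n \<omega>}"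

definition centering :: "real \<Rightarrow> nat \<Rightarrow> real" where
  "centering \<gamma> n = ln (real n / \<gamma>) - ln (ln (real n))"

end

theory Submission
  imports Defs "HOL-Real_Asymp.Real_Asymp"
begin

text \<open>
  Write \<open>b = centering \<gamma> n\<close>, \<open>c\<^sub>i = (n / i) powr \<gamma>\<close> and \<open>Z\<^sub>i = X\<^sub>i / c\<^sub>i\<close>. The \<open>Z\<^sub>i\<close> are
  independent, \<open>Z\<^sub>i\<close> is exponential with rate \<open>c\<^sub>i\<close>, and the rescaled maximum is the largest of them.
  The event that index \<open>k\<close> is the strict winner, with value \<open>t + b\<close>, has density
  \<open>c\<^sub>k exp (- c\<^sub>k (t + b)) (\<Prod>i \<noteq> k. 1 - exp (- c\<^sub>i (t + b)))\<close> in \<open>t\<close>, for \<open>t + b > 0\<close>.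
  Put \<open>k = n - j\<close> and \<open>s = (j / n) ln n\<close>, so that consecutive values of \<open>s\<close> are
  \<open>\<delta> = ln n / n\<close> apart. Three effects then separate. Since \<open>c\<^sub>k - 1\<close> is about \<open>\<gamma> s / ln n\<close> while \<open>t + b\<close>
  is about \<open>ln n\<close>, the exponent \<open>c\<^sub>k (t + b)\<close> exceeds \<open>t + b\<close> by about \<open>\<gamma> s\<close>. The centering is chosen so
  that \<open>exp (- (t + b)) / \<delta>\<close> tends to \<open>\<gamma> exp (- t)\<close>. The product tends to \<open>exp (- exp (- t))\<close>,
  because the sum of the terms \<open>exp (- c\<^sub>i (t + b))\<close> is close to a geometric series with sum close
  to \<open>exp (- t)\<close>. Hence the joint density, spread over steps of
  length \<open>\<delta>\<close> in the variable \<open>s\<close>, tends pointwise to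
  \<open>(exp (- t) exp (- exp (- t))) (\<gamma> exp (- \<gamma> s))\<close>, which is the density of the claimed limit.

  Pointwise convergence of densities is enough, and in fact lower bounds are enough. If every
  nonnegative bounded continuous test function has limit inferior of expectations at least the
  expectation under the limit law, then applying this to \<open>C + f\<close> and to \<open>C - f\<close> gives convergence for
  \<open>f\<close> (\<open>converges_in_distributionI_liminf\<close>), and Fatou's lemma turns a pointwise lower bound on
  the densities into such an inequality. So ties can be discarded
  (\<open>weighted_max_nn_integral_ge\<close>), and the product need only be bounded below
  (\<open>prod_one_minus_exp_ge\<close>). These bounds meet the limits of the three factors in
  \<open>liminf_density_ge\<close>.
\<close>

section \<open>Convergence in distribution from one-sided bounds\<close>

text \<open>
  One-sided bounds suffice because the class of bounded continuous functions is closed under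
  negation: the bound for \<open>f\<close> plus a constant controls the limit inferior of the expectations of
  \<open>f\<close>, the bound for \<open>- f\<close> plus a constant their limit superior.
\<close>
lemma converges_in_distributionI_liminf:
  fixes Y :: "nat \<Rightarrow> 'a \<Rightarrow> 'c :: topological_space"
  assumes M: "prob_space M" and N: "prob_space N"
    and Y [measurable]: "\<And>n. Y n \<in> borel_measurable M" and Z [measurable]: "Z \<in> borel_measurable N"
    and liminf: "\<And>\<phi> :: 'c \<Rightarrow> real. continuous_on UNIV \<phi> \<Longrightarrow> bounded (range \<phi>) \<Longrightarrow> (\<And>x. 0 \<le> \<phi> x) \<Longrightarrow>
      (\<integral>\<^sup>+\<omega>. ennreal (\<phi> (Z \<omega>)) \<partial>N) \<le> liminf (\<lambda>n. \<integral>\<^sup>+\<omega>. ennreal (\<phi> (Y n \<omega>)) \<partial>M)"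
  shows "converges_in_distribution M Y N Z"
proof -
  interpret M: prob_space M by fact
  interpret N: prob_space N by fact
  have ev: "eventually (\<lambda>n. (\<integral>\<omega>. f (Z \<omega>) \<partial>N) - e < (\<integral>\<omega>. f (Y n \<omega>) \<partial>M)) sequentially"
    if f: "continuous_on UNIV f" "bounded (range f)" and e: "e > 0" for f :: "'c \<Rightarrow> real" and e
  proof -
    from f(2) obtain B where B: "\<And>x. \<bar>f x\<bar> \<le> B" by (auto simp: bounded_iff)
    have [measurable]: "f \<in> borel_measurable borel"
      using f(1) by (rule borel_measurable_continuous_onI)
    have iY: "integrable M (\<lambda>\<omega>. f (Y n \<omega>))" for n
      by (rule M.integrable_const_bound[of _ B]) (auto simp: B)
    have iZ: "integrable N (\<lambda>\<omega>. f (Z \<omega>))"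
      by (rule N.integrable_const_bound[of _ B]) (auto simp: B)
    \<comment> \<open>The shift makes the test function at least 1. Its integral is then positive, so that
      subtracting \<open>e\<close> strictly decreases it even though \<^const>\<open>ennreal\<close> sends negative numbers to 0.\<close>
    define \<phi> where "\<phi> x = f x + (B + 1)" for x
    have \<phi>1: "1 \<le> \<phi> x" for x using B[of x] by (auto simp: \<phi>_def)
    have bd: "bounded (range \<phi>)"
      using bounded_translation[OF f(2), of "B + 1"] by (simp add: \<phi>_def image_image add.commute)
    have \<phi>0: "0 \<le> \<phi> x" for x using \<phi>1[of x] by linarith
    have nnY: "(\<integral>\<^sup>+\<omega>. ennreal (\<phi> (Y n \<omega>)) \<partial>M) = ennreal ((\<integral>\<omega>. f (Y n \<omega>) \<partial>M) + (B + 1))" for n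
    proof -
      have "integrable M (\<lambda>\<omega>. \<phi> (Y n \<omega>))" using iY by (simp add: \<phi>_def)
      then have "(\<integral>\<^sup>+\<omega>. ennreal (\<phi> (Y n \<omega>)) \<partial>M) = ennreal (\<integral>\<omega>. \<phi> (Y n \<omega>) \<partial>M)"
        by (intro nn_integral_eq_integral) (simp_all add: \<phi>0)
      also have "(\<integral>\<omega>. \<phi> (Y n \<omega>) \<partial>M) = (\<integral>\<omega>. f (Y n \<omega>) \<partial>M) + (B + 1)"
        using iY by (simp add: \<phi>_def M.prob_space)
      finally show ?thesis .
    qed
    have nnZ: "(\<integral>\<^sup>+\<omega>. ennreal (\<phi> (Z \<omega>)) \<partial>N) = ennreal ((\<integral>\<omega>. f (Z \<omega>) \<partial>N) + (B + 1))"
    proof -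
      have "integrable N (\<lambda>\<omega>. \<phi> (Z \<omega>))" using iZ by (simp add: \<phi>_def)
      then have "(\<integral>\<^sup>+\<omega>. ennreal (\<phi> (Z \<omega>)) \<partial>N) = ennreal (\<integral>\<omega>. \<phi> (Z \<omega>) \<partial>N)"
        by (intro nn_integral_eq_integral) (simp_all add: \<phi>0)
      also have "(\<integral>\<omega>. \<phi> (Z \<omega>) \<partial>N) = (\<integral>\<omega>. f (Z \<omega>) \<partial>N) + (B + 1)"
        using iZ by (simp add: \<phi>_def N.prob_space)
      finally show ?thesis .
    qed
    have Zpos: "0 < (\<integral>\<omega>. f (Z \<omega>) \<partial>N) + (B + 1)"
    proof -
      have "(\<integral>\<omega>. - B \<partial>N) \<le> (\<integral>\<omega>. f (Z \<omega>) \<partial>N)"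
        using iZ B by (intro integral_mono) (auto simp: abs_le_iff minus_le_iff)
      then show ?thesis by (simp add: N.prob_space)
    qed
    have "(\<integral>\<^sup>+\<omega>. ennreal (\<phi> (Z \<omega>)) \<partial>N) \<le> liminf (\<lambda>n. \<integral>\<^sup>+\<omega>. ennreal (\<phi> (Y n \<omega>)) \<partial>M)"
      using f(1) by (intro liminf bd \<phi>0) (auto simp: \<phi>_def intro!: continuous_intros)
    moreover have "ennreal ((\<integral>\<omega>. f (Z \<omega>) \<partial>N) + (B + 1) - e) < (\<integral>\<^sup>+\<omega>. ennreal (\<phi> (Z \<omega>)) \<partial>N)"
      using Zpos e by (simp add: nnZ ennreal_lessI)
    ultimately have "eventually (\<lambda>n. ennreal ((\<integral>\<omega>. f (Z \<omega>) \<partial>N) + (B + 1) - e)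
        < (\<integral>\<^sup>+\<omega>. ennreal (\<phi> (Y n \<omega>)) \<partial>M)) sequentially"
      by (auto simp: le_Liminf_iff)
    then show "eventually (\<lambda>n. (\<integral>\<omega>. f (Z \<omega>) \<partial>N) - e < (\<integral>\<omega>. f (Y n \<omega>) \<partial>M)) sequentially"
    proof eventually_elim
      case (elim n)
      then have "\<not> (\<integral>\<omega>. f (Y n \<omega>) \<partial>M) + (B + 1) \<le> (\<integral>\<omega>. f (Z \<omega>) \<partial>N) + (B + 1) - e"
        unfolding nnY by (metis ennreal_leI leD)
      then show ?case by linarith
    qed
  qed
  have "(\<lambda>n. \<integral>\<omega>. f (Y n \<omega>) \<partial>M) \<longlonglongrightarrow> (\<integral>\<omega>. f (Z \<omega>) \<partial>N)"
    if f: "continuous_on UNIV f" "bounded (range f)" for f :: "'c \<Rightarrow> real"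
  proof (rule tendstoI)
    fix e :: real assume e: "e > 0"
    have f': "continuous_on UNIV (\<lambda>x. - f x)" "bounded (range (\<lambda>x. - f x))"
      using f by (auto simp: bounded_iff intro: continuous_intros)
    from ev[OF f e] ev[OF f' e]
    show "eventually (\<lambda>n. dist (\<integral>\<omega>. f (Y n \<omega>) \<partial>M) (\<integral>\<omega>. f (Z \<omega>) \<partial>N) < e) sequentially"
      by eventually_elim (auto simp: dist_real_def)
  qed
  then show ?thesis by (simp add: converges_in_distribution_def)
qed

section \<open>The density of the Gumbel law\<close>

definition gumbel_density :: "real \<Rightarrow> real" where
  "gumbel_density t = exp (- t) * exp (- exp (- t))"

lemma gumbel_density_nonneg: "0 \<le> gumbel_density t"
  by (simp add: gumbel_density_def)

lemma borel_measurable_gumbel_density [measurable]: "gumbel_density \<in> borel_measurable borel"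
  unfolding gumbel_density_def by measurable

lemma emeasure_gumbel_density_atMost:
  "emeasure (density lborel gumbel_density) {..x} = ennreal (exp (- exp (- x)))"
proof -
  have "emeasure (density lborel gumbel_density) {..x}
      = (\<integral>\<^sup>+t. ennreal (gumbel_density t) * indicator {..x} t \<partial>lborel)"
    by (subst emeasure_density) auto
  also have "\<dots> = (\<integral>\<^sup>+t. ennreal (gumbel_density (- t)) * indicator {- x..} t \<partial>lborel)"
    by (subst nn_integral_real_affine[where c = "-1" and t = 0])
       (auto intro!: nn_integral_cong split: split_indicator)
  also have "\<dots> = ennreal (0 - (- exp (- exp (- x))))"
  proof (rule nn_integral_FTC_atLeast)
    show "((\<lambda>t::real. - exp (- exp t)) \<longlongrightarrow> 0) at_top"
      by real_asymp
  qed (auto intro!: derivative_eq_intros simp: gumbel_density_def)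
  finally show ?thesis by simp
qed

text \<open>
  Finiteness is what makes the measure determined by its distribution function.
\<close>
lemma finite_borel_measure_gumbel: "finite_borel_measure (density lborel gumbel_density)"
proof -
  let ?D = "density lborel gumbel_density"
  have "(\<Union>i::nat. {..real i}) = UNIV"
    by (auto simp: real_arch_simple)
  then have "emeasure ?D UNIV = (SUP i::nat. emeasure ?D {..real i})"
    by (subst SUP_emeasure_incseq) (auto simp: incseq_def)
  also have "\<dots> \<le> 1"
    by (auto intro!: SUP_least simp: emeasure_gumbel_density_atMost)
  finally have "emeasure ?D (space ?D) \<noteq> \<infinity>"
    by (auto simp: top_unique)
  then show ?thesis
    by (simp add: finite_borel_measure_def finite_borel_measure_axioms_def finite_measureI)
qed

lemma distr_gumbel:
  assumes "prob_space N" and "gumbel_distributed N G"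
  shows "distr N borel G = density lborel gumbel_density"
proof (rule cdf_unique')
  have G [measurable]: "G \<in> borel_measurable N" using assms by (simp add: gumbel_distributed_def)
  have "real_distribution (distr N borel G)"
    by (rule prob_space.real_distribution_distr[OF assms(1)]) simp
  then show "finite_borel_measure (distr N borel G)"
    by (rule real_distribution.finite_borel_measure_M)
  show "cdf (distr N borel G) = cdf (density lborel gumbel_density)"
    using assms(2) by (auto simp: gumbel_distributed_def cdf_def measure_def emeasure_gumbel_density_atMost)
qed (rule finite_borel_measure_gumbel)

section \<open>The largest of independent exponential variables\<close>

lemma (in prob_space) exponential_distributed_divide:
  assumes "distributed M lborel X (exponential_density 1)" and "0 < c"
  shows "distributed M lborel (\<lambda>\<omega>. X \<omega> / c) (exponential_density c)"
  unfolding exponential_distributed_iff[OF \<open>0 < c\<close>]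
proof (intro conjI allI impI)
  have X: "X \<in> borel_measurable M" "\<And>a. a \<ge> 0 \<Longrightarrow> \<P>(x in M. X x \<le> a) = 1 - exp (- a)"
    using assms exponential_distributed_iff[of 1 X] by auto
  show "(\<lambda>\<omega>. X \<omega> / c) \<in> borel_measurable M" using X(1) by measurable
  fix a :: real assume "0 \<le> a"
  then show "\<P>(x in M. X x / c \<le> a) = 1 - exp (- a * c)"
    using X(2)[of "a * c"] assms(2) by (simp add: pos_divide_le_eq)
qed

text \<open>
  For negative \<open>u\<close> both sides vanish, since \<^const>\<open>ennreal\<close> sends negative numbers to 0. Having one
  formula for all \<open>u\<close> makes the right-hand side visibly measurable in \<open>u\<close>.
\<close>
lemma (in prob_space) emeasure_exponential_lessThan:
  assumes D: "distributed M lborel X (exponential_density c)" and c: "0 < c"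
  shows "emeasure (distr M borel X) {..<u} = ennreal (1 - exp (- (c * u)))"
proof -
  have [measurable]: "X \<in> borel_measurable M" using D by (simp add: distributed_def)
  have E: "distr M borel X = density lborel (exponential_density c)"
    using distributed_distr_eq_density[OF D] by (metis distr_cong sets_lborel)
  have nonneg: "emeasure (distr M borel X) {..<u} = ennreal (1 - exp (- (c * u)))" if u: "0 \<le> u" for u
  proof -
    have "emeasure (distr M borel X) {..<u} = emeasure (distr M borel X) {..u}"
      unfolding E using AE_lborel_singleton[of u]
      by (intro emeasure_eq_AE) (auto simp: AE_density elim!: eventually_mono)
    also have "\<dots> = ennreal (\<P>(x in M. X x \<le> u))"
      by (subst emeasure_distr) (auto simp: emeasure_eq_measure vimage_def Int_def conj_commute)
    also have "\<dots> = ennreal (1 - exp (- (c * u)))"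
      using exponential_distributedD_le[OF D u c] by (simp add: mult.commute)
    finally show ?thesis .
  qed
  show ?thesis
  proof (cases "0 \<le> u")
    case False
    then have "emeasure (distr M borel X) {..<u} \<le> emeasure (distr M borel X) {..<0}"
      by (intro emeasure_mono) auto
    also have "\<dots> = 0" using nonneg[of 0] by simp
    finally show ?thesis using False c by (simp add: ennreal_neg mult_nonneg_nonpos)
  qed (rule nonneg)
qed

text \<open>
  By independence the joint law of \<open>Z\<close> is a product measure, and Fubini allows the winner's
  value \<open>u\<close> to be integrated last. For fixed \<open>u\<close> the remaining event is a box, whose measure is
  the product of the distribution functions.
\<close>
lemma (in prob_space) nn_integral_strict_max_exponential:
  fixes Z :: "'i \<Rightarrow> 'a \<Rightarrow> real" and c :: "'i \<Rightarrow> real"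
  assumes J: "finite J" "k \<notin> J"
    and indep: "indep_vars (\<lambda>_. borel) Z (insert k J)"
    and c: "\<And>i. i \<in> insert k J \<Longrightarrow> 0 < c i"
    and Z: "\<And>i. i \<in> insert k J \<Longrightarrow> distributed M lborel (Z i) (exponential_density (c i))"
    and g [measurable]: "g \<in> borel_measurable borel"
  shows "(\<integral>\<^sup>+\<omega>. g (Z k \<omega>) * indicator {\<omega>. \<forall>i\<in>J. Z i \<omega> < Z k \<omega>} \<omega> \<partial>M)
    = (\<integral>\<^sup>+u. g u * ennreal (exponential_density (c k) u * (\<Prod>i\<in>J. 1 - exp (- (c i * u)))) \<partial>lborel)"
proof -
  define I where "I = insert k J"
  have I: "finite I" "I \<noteq> {}" using J by (auto simp: I_def)
  have Zm [measurable]: "Z i \<in> borel_measurable M" if "i \<in> I" for i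
    using Z[of i] that by (auto simp: I_def distributed_def)
  \<comment> \<open>Outside \<open>I\<close> any probability measure will do; the locale for product measures asks for one
    at every index.\<close>
  define D where "D i = (if i \<in> I then distr M borel (Z i) else return borel 0)" for i
  have prob_D: "prob_space (D i)" for i
    by (auto simp: D_def intro!: prob_space_distr prob_space_return)
  interpret P: product_prob_space D
    using prob_D by (simp add: product_prob_space_def product_prob_space_axioms_def
        product_sigma_finite_def prob_space_imp_sigma_finite)
  have sets_D [measurable_cong, simp]: "sets (D i) = sets borel" for i by (simp add: D_def)
  have space_D [simp]: "space (D i) = UNIV" for i by (simp add: D_def)
  have sets_PiM_D: "sets (PiM I D) = sets (PiM I (\<lambda>_. borel))" by (intro sets_PiM_cong) auto
  have joint: "distr M (PiM I (\<lambda>_. borel)) (\<lambda>\<omega>. \<lambda>i\<in>I. Z i \<omega>) = PiM I D"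
    using indep_vars_iff_distr_eq_PiM'[OF I(2), where M' = "\<lambda>_. borel" and X = Z] indep Zm
    by (auto simp: I_def[symmetric] D_def intro!: PiM_cong)
  define h where "h z = g (z k) * indicator {z. \<forall>i\<in>J. z i < z k} z" for z :: "'i \<Rightarrow> real"
  have h: "h \<in> borel_measurable (PiM I (\<lambda>_. borel))"
    unfolding h_def using J(1) by (measurable, auto simp: I_def)
  have "(\<integral>\<^sup>+\<omega>. g (Z k \<omega>) * indicator {\<omega>. \<forall>i\<in>J. Z i \<omega> < Z k \<omega>} \<omega> \<partial>M)
      = (\<integral>\<^sup>+\<omega>. h (\<lambda>i\<in>I. Z i \<omega>) \<partial>M)"
    by (intro nn_integral_cong) (auto simp: h_def I_def indicator_def)
  also have "\<dots> = (\<integral>\<^sup>+z. h z \<partial>distr M (PiM I (\<lambda>_. borel)) (\<lambda>\<omega>. \<lambda>i\<in>I. Z i \<omega>))"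
    using h by (subst nn_integral_distr) auto
  also have "\<dots> = (\<integral>\<^sup>+z. h z \<partial>PiM (insert k J) D)" by (simp only: joint) (simp only: I_def)
  also have "\<dots> = (\<integral>\<^sup>+u. (\<integral>\<^sup>+z. h (z(k := u)) \<partial>PiM J D) \<partial>D k)"
    using J h sets_PiM_D by (intro P.product_nn_integral_insert_rev) (auto simp: I_def cong: measurable_cong_sets)
  also have "\<dots> = (\<integral>\<^sup>+u. g u * (\<Prod>i\<in>J. emeasure (D i) {..<u}) \<partial>D k)"
  proof (rule nn_integral_cong)
    fix u :: real
    have "(\<integral>\<^sup>+z. h (z(k := u)) \<partial>PiM J D) = (\<integral>\<^sup>+z. g u * indicator (\<Pi>\<^sub>E i\<in>J. {..<u}) z \<partial>PiM J D)"
      using J(2) by (intro nn_integral_cong) 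
        (auto simp: h_def space_PiM indicator_def PiE_iff split: if_splits)
    also have "\<dots> = g u * (\<Prod>i\<in>J. emeasure (D i) {..<u})"
      using J(1) by (simp add: nn_integral_cmult_indicator P.emeasure_PiM sets_PiM_I_finite)
    finally show "(\<integral>\<^sup>+z. h (z(k := u)) \<partial>PiM J D) = g u * (\<Prod>i\<in>J. emeasure (D i) {..<u})" .
  qed
  also have "\<dots> = (\<integral>\<^sup>+u. g u * (\<Prod>i\<in>J. ennreal (1 - exp (- (c i * u)))) \<partial>D k)"
    using c Z by (intro nn_integral_cong arg_cong2[where f = "(*)"] prod.cong refl)
      (auto simp: D_def I_def emeasure_exponential_lessThan)
  also have "D k = density lborel (exponential_density (c k))"
    using distributed_distr_eq_density[OF Z[of k]] by (simp add: D_def I_def) (metis distr_cong sets_lborel)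
  also have "(\<integral>\<^sup>+u. g u * (\<Prod>i\<in>J. ennreal (1 - exp (- (c i * u)))) \<partial>density lborel (exponential_density (c k)))
     = (\<integral>\<^sup>+u. ennreal (exponential_density (c k) u) * (g u * (\<Prod>i\<in>J. ennreal (1 - exp (- (c i * u))))) \<partial>lborel)"
    by (subst nn_integral_density) auto
  also have "\<dots> = (\<integral>\<^sup>+u. g u * ennreal (exponential_density (c k) u * (\<Prod>i\<in>J. 1 - exp (- (c i * u)))) \<partial>lborel)"
  proof (rule nn_integral_cong)
    fix u :: real
    show "ennreal (exponential_density (c k) u) * (g u * (\<Prod>i\<in>J. ennreal (1 - exp (- (c i * u)))))
      = g u * ennreal (exponential_density (c k) u * (\<Prod>i\<in>J. 1 - exp (- (c i * u))))"
    proof (cases "0 \<le> u")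
      case True
      have "(\<Prod>i\<in>J. ennreal (1 - exp (- (c i * u)))) = ennreal (\<Prod>i\<in>J. 1 - exp (- (c i * u)))"
        using True c by (intro prod_ennreal) (auto simp: less_imp_le)
      then show ?thesis
        using c[of k] by (simp add: ennreal_mult' exponential_density_nonneg mult_ac)
    qed (simp add: exponential_density_def)
  qed
  finally show ?thesis .
qed

text \<open>
  The events that \<open>k\<close> is the strict winner are disjoint, and on each of them the maximum and its
  position are read off from \<open>k\<close>. Only ties are lost on the left,
  and for \<open>n \<ge> 1\<close> they have probability 0, so the bound is sharp.
\<close>
lemma (in prob_space) weighted_max_nn_integral_ge:
  fixes X :: "nat \<Rightarrow> 'a \<Rightarrow> real" and \<gamma> b :: real and \<phi> :: "real \<Rightarrow> nat \<Rightarrow> ennreal"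
  assumes indep: "indep_vars (\<lambda>_. borel) X {1..}"
    and X: "\<And>i. i \<ge> 1 \<Longrightarrow> distributed M lborel (X i) (exponential_density 1)"
    and \<phi> [measurable]: "\<And>k. (\<lambda>t. \<phi> t k) \<in> borel_measurable borel"
  defines "c \<equiv> \<lambda>n i. (real n / real i) powr \<gamma>"
  shows "(\<Sum>k=1..n. \<integral>\<^sup>+t. \<phi> t k * ennreal (exponential_density (c n k) (t + b)
            * (\<Prod>i\<in>{1..n} - {k}. 1 - exp (- (c n i * (t + b))))) \<partial>lborel)
    \<le> (\<integral>\<^sup>+\<omega>. \<phi> (weighted_max \<gamma> X n \<omega> / real n powr \<gamma> - b) (weighted_argmax \<gamma> X n \<omega>) \<partial>M)"
proof -
  define Z where "Z i \<omega> = X i \<omega> / c n i" for i \<omega>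
  define S where "S k = {\<omega>. \<forall>i\<in>{1..n} - {k}. Z i \<omega> < Z k \<omega>}" for k
  have c_pos: "0 < c n i" if "i \<in> {1..n}" for i using that by (auto simp: c_def)
  have [measurable]: "X i \<in> borel_measurable M" if "i \<ge> 1" for i
    using X[OF that] by (simp add: distributed_def)
  have [measurable]: "Z i \<in> borel_measurable M" if "i \<in> {1..n}" for i
    using that unfolding Z_def by (intro borel_measurable_divide) auto
  have indep_Z: "indep_vars (\<lambda>_. borel) Z {1..n}"
    using indep_vars_compose2[OF indep_vars_subset[OF indep], of "{1..n}" "\<lambda>i x. x / c n i" "\<lambda>_. borel"]
    by (auto simp: Z_def[abs_def])
  have dist_Z: "distributed M lborel (Z i) (exponential_density (c n i))" if "i \<in> {1..n}" for i
    unfolding Z_def using that by (intro exponential_distributed_divide X c_pos) auto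
  have term_k: "(\<integral>\<^sup>+t. \<phi> t k * ennreal (exponential_density (c n k) (t + b)
            * (\<Prod>i\<in>{1..n} - {k}. 1 - exp (- (c n i * (t + b))))) \<partial>lborel)
      = (\<integral>\<^sup>+\<omega>. \<phi> (Z k \<omega> - b) k * indicator (S k) \<omega> \<partial>M)" if k: "k \<in> {1..n}" for k
  proof -
    have ins: "insert k ({1..n} - {k}) = {1..n}" using k by auto
    have "(\<integral>\<^sup>+\<omega>. \<phi> (Z k \<omega> - b) k * indicator (S k) \<omega> \<partial>M)
        = (\<integral>\<^sup>+u. \<phi> (u - b) k * ennreal (exponential_density (c n k) u
            * (\<Prod>i\<in>{1..n} - {k}. 1 - exp (- (c n i * u)))) \<partial>lborel)"
      unfolding S_def
    proof (rule nn_integral_strict_max_exponential)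
      show "indep_vars (\<lambda>_. borel) Z (insert k ({1..n} - {k}))" unfolding ins by (rule indep_Z)
    qed (use k in \<open>auto intro: c_pos dist_Z\<close>)
    also have "\<dots> = (\<integral>\<^sup>+t. \<phi> t k * ennreal (exponential_density (c n k) (t + b)
            * (\<Prod>i\<in>{1..n} - {k}. 1 - exp (- (c n i * (t + b))))) \<partial>lborel)"
      by (subst nn_integral_real_affine[where c = 1 and t = b]) (auto simp: add.commute)
    finally show ?thesis ..
  qed
  have Z_eq: "Z i \<omega> = real i powr \<gamma> * X i \<omega> / real n powr \<gamma>" if "i \<in> {1..n}" for i \<omega>
    using that by (simp add: Z_def c_def powr_divide)
  have on_S: "weighted_max \<gamma> X n \<omega> / real n powr \<gamma> = Z k \<omega>" "weighted_argmax \<gamma> X n \<omega> = k"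
    if k: "k \<in> {1..n}" and S: "\<omega> \<in> S k" for k \<omega>
  proof -
    have less: "real i powr \<gamma> * X i \<omega> < real k powr \<gamma> * X k \<omega>" if "i \<in> {1..n}" "i \<noteq> k" for i
      using S k that by (auto simp: S_def Z_eq divide_less_cancel)
    have max: "weighted_max \<gamma> X n \<omega> = real k powr \<gamma> * X k \<omega>"
      unfolding weighted_max_def
    proof (rule Max_eqI)
      fix y assume "y \<in> (\<lambda>i. real i powr \<gamma> * X i \<omega>) ` {1..n}"
      then obtain i where "i \<in> {1..n}" "y = real i powr \<gamma> * X i \<omega>" by blast
      then show "y \<le> real k powr \<gamma> * X k \<omega>" using less[of i] by (cases "i = k") auto
    qed (use k in auto)
    then show "weighted_max \<gamma> X n \<omega> / real n powr \<gamma> = Z k \<omega>" using k by (simp add: Z_eq)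
    have "{i \<in> {1..n}. real i powr \<gamma> * X i \<omega> = weighted_max \<gamma> X n \<omega>} = {k}"
    proof (intro equalityI subsetI)
      fix i assume "i \<in> {i \<in> {1..n}. real i powr \<gamma> * X i \<omega> = weighted_max \<gamma> X n \<omega>}"
      then show "i \<in> {k}" using less[of i] max by (cases "i = k") auto
    qed (use k max in auto)
    then show "weighted_argmax \<gamma> X n \<omega> = k" by (simp add: weighted_argmax_def)
  qed
  have "(\<Sum>k=1..n. \<integral>\<^sup>+\<omega>. \<phi> (Z k \<omega> - b) k * indicator (S k) \<omega> \<partial>M)
      = (\<integral>\<^sup>+\<omega>. (\<Sum>k=1..n. \<phi> (Z k \<omega> - b) k * indicator (S k) \<omega>) \<partial>M)"
    unfolding S_def by (intro nn_integral_sum[symmetric]) measurable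
  also have "\<dots> \<le> (\<integral>\<^sup>+\<omega>. \<phi> (weighted_max \<gamma> X n \<omega> / real n powr \<gamma> - b) (weighted_argmax \<gamma> X n \<omega>) \<partial>M)"
  proof (rule nn_integral_mono)
    fix \<omega>
    show "(\<Sum>k=1..n. \<phi> (Z k \<omega> - b) k * indicator (S k) \<omega>)
      \<le> \<phi> (weighted_max \<gamma> X n \<omega> / real n powr \<gamma> - b) (weighted_argmax \<gamma> X n \<omega>)"
    proof (cases "\<exists>k\<in>{1..n}. \<omega> \<in> S k")
      case True
      then obtain k where k: "k \<in> {1..n}" "\<omega> \<in> S k" by auto
      have "\<omega> \<notin> S i" if "i \<in> {1..n} - {k}" for i
        using that k on_S(2)[of i \<omega>] on_S(2)[OF k] by auto
      then have "(\<Sum>k=1..n. \<phi> (Z k \<omega> - b) k * indicator (S k) \<omega>) = \<phi> (Z k \<omega> - b) k"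
        using k by (subst sum.remove[of _ k]) auto
      then show ?thesis using on_S[OF k] by simp
    qed auto
  qed
  finally show ?thesis by (subst sum.cong[OF refl term_k])
qed

section \<open>Asymptotics of the joint density\<close>

text \<open>
  This is \<open>1 + y \<le> exp y\<close> at \<open>y = q / (1 - q)\<close>, inverted; it reduces a lower bound on
  a product of terms \<open>1 - q\<^sub>i\<close> to an upper bound on a sum.
\<close>
lemma exp_neg_odds_le_one_minus:
  fixes q :: real
  assumes "q < 1"
  shows "exp (- (q / (1 - q))) \<le> 1 - q"
proof -
  have "1 / (1 - q) = 1 + q / (1 - q)" using assms by (simp add: field_simps)
  also have "\<dots> \<le> exp (q / (1 - q))" by (rule exp_ge_add_one_self)
  finally have "1 \<le> exp (q / (1 - q)) * (1 - q)" using assms by (simp add: field_simps)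
  then show ?thesis by (simp add: exp_minus field_simps)
qed

text \<open>
  The convexity estimate \<open>(n / i) powr \<gamma> \<ge> 1 + \<gamma> (n - i) / n\<close> bounds the numbers subtracted from 1 by a
  geometric sequence in \<open>n - i\<close> with ratio \<open>exp (- \<gamma> x / n)\<close>, whose sum to infinity appears
  in the statement. With \<open>x = t + centering \<gamma> n\<close> nothing is lost in the limit: only indices with
  \<open>n - i\<close> of order \<open>n / ln n\<close> contribute, and there the estimate is sharp to first order.
\<close>
lemma prod_one_minus_exp_ge:
  fixes x \<gamma> :: real
  assumes "0 < \<gamma>" "0 < x" "0 < n"
  shows "exp (- (exp (- x) / (1 - exp (- x)) / (1 - exp (- (\<gamma> * x / real n)))))
    \<le> (\<Prod>i=1..n. 1 - exp (- ((real n / real i) powr \<gamma> * x)))"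
proof -
  define r where "r = exp (- (\<gamma> * x / real n))"
  define K where "K = exp (- x) / (1 - exp (- x))"
  define q where "q i = exp (- ((real n / real i) powr \<gamma> * x))" for i
  have r: "0 < r" "r < 1" using assms by (auto simp: r_def)
  have ex: "exp (- x) < 1" "K > 0" using assms by (auto simp: K_def)
  have q_le: "q i \<le> exp (- x) * r ^ (n - i)" if "i \<in> {1..n}" for i
  proof -
    have i: "0 < i" "i \<le> n" using that by auto
    have "1 + \<gamma> * real (n - i) / real n = 1 + \<gamma> * (1 - real i / real n)"
      using i by (simp add: of_nat_diff field_simps)
    also have "\<dots> \<le> 1 + \<gamma> * (- ln (real i / real n))"
      using i assms ln_le_minus_one[of "real i / real n"] by (intro add_left_mono mult_left_mono) auto
    also have "\<dots> \<le> exp (\<gamma> * (- ln (real i / real n)))" by (rule exp_ge_add_one_self)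
    also have "\<dots> = (real n / real i) powr \<gamma>"
      using i assms by (simp add: powr_def ln_div algebra_simps)
    finally have "(1 + \<gamma> * real (n - i) / real n) * x \<le> (real n / real i) powr \<gamma> * x"
      using assms by (intro mult_right_mono) auto
    then have "q i \<le> exp (- ((1 + \<gamma> * real (n - i) / real n) * x))" by (simp add: q_def)
    also have "\<dots> = exp (- x) * r ^ (n - i)"
      by (simp add: r_def exp_of_nat_mult[symmetric] exp_add[symmetric] algebra_simps)
    finally show ?thesis .
  qed
  have q_le': "q i \<le> exp (- x)" if "i \<in> {1..n}" for i
    using q_le[OF that] r by (elim order_trans) (simp add: power_le_one)
  have "(\<Sum>i=1..n. q i / (1 - q i)) \<le> (\<Sum>i=1..n. K * r ^ (n - i))"
  proof (rule sum_mono)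
    fix i assume i: "i \<in> {1..n}"
    have "q i / (1 - q i) \<le> (exp (- x) * r ^ (n - i)) / (1 - exp (- x))"
      using q_le[OF i] q_le'[OF i] ex r by (intro frac_le) auto
    then show "q i / (1 - q i) \<le> K * r ^ (n - i)" by (simp add: K_def)
  qed
  also have "\<dots> = K * (\<Sum>j<n. r ^ j)"
    unfolding sum_distrib_left[symmetric]
    by (intro arg_cong[where f = "\<lambda>s. K * s"] sum.reindex_bij_witness[of _ "\<lambda>j. n - j" "\<lambda>i. n - i"]) auto
  also have "\<dots> \<le> K * (1 / (1 - r))"
    using r ex by (intro mult_left_mono) (auto simp: sum_gp_strict divide_right_mono)
  finally have "exp (- (K / (1 - r))) \<le> exp (\<Sum>i=1..n. - (q i / (1 - q i)))"
    by (simp add: sum_negf)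
  also have "\<dots> = (\<Prod>i=1..n. exp (- (q i / (1 - q i))))" by (simp add: exp_sum)
  also have "\<dots> \<le> (\<Prod>i=1..n. 1 - q i)"
  proof (rule prod_mono)
    fix i assume "i \<in> {1..n}"
    then have "q i < 1" using q_le' ex(1) by (metis order.strict_trans1)
    then show "0 \<le> exp (- (q i / (1 - q i))) \<and> exp (- (q i / (1 - q i))) \<le> 1 - q i"
      by (simp add: exp_neg_odds_le_one_minus)
  qed
  finally show ?thesis by (simp add: K_def r_def q_def)
qed

text \<open>
  For rates \<open>c\<^sub>i = (n / i) powr \<gamma>\<close> the right-hand side is the density at \<open>x\<close> of the event that index
  \<open>n - j\<close> is the strict winner. The left-hand side depends on \<open>j\<close> only through an
  upper bound \<open>v\<close> of \<open>j / n\<close>; this is what allows \<open>v = s / ln n\<close> to replace the integer part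
  \<open>j = \<lfloor>s n / ln n\<rfloor>\<close> when the limit is taken.
\<close>
lemma strict_max_density_ge:
  fixes x \<gamma> v :: real
  assumes "0 < \<gamma>" "0 < x" "j < n" "real j / real n \<le> v" "v < 1"
  shows "exp (- x) * exp (- (((1 / (1 - v)) powr \<gamma> - 1) * x))
      * exp (- (exp (- x) / (1 - exp (- x)) / (1 - exp (- (\<gamma> * x / real n)))))
    \<le> exponential_density ((real n / real (n - j)) powr \<gamma>) x
      * (\<Prod>i\<in>{1..n} - {n - j}. 1 - exp (- ((real n / real i) powr \<gamma> * x)))"
proof -
  define c where "c i = (real n / real i) powr \<gamma>" for i
  have n: "0 < n" using assms by simp
  have c_ge: "1 \<le> c i" if "i \<in> {1..n}" for i
    using that assms by (auto simp: c_def intro!: ge_one_powr_ge_zero)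
  have k: "n - j \<in> {1..n}" using assms by auto
  have "real n / real (n - j) = 1 / (1 - real j / real n)"
    using assms by (simp add: of_nat_diff field_simps)
  also have "\<dots> \<le> 1 / (1 - v)" using assms by (intro divide_left_mono) auto
  finally have "c (n - j) \<le> (1 / (1 - v)) powr \<gamma>"
    unfolding c_def using assms by (intro powr_mono2) auto
  then have "exp (- x) * exp (- (((1 / (1 - v)) powr \<gamma> - 1) * x)) \<le> exp (- (x * c (n - j)))"
    using assms by (simp add: exp_add[symmetric] algebra_simps)
  also have "\<dots> \<le> exponential_density (c (n - j)) x"
    using assms c_ge[OF k] by (simp add: exponential_density_def)
  finally have dens: "exp (- x) * exp (- (((1 / (1 - v)) powr \<gamma> - 1) * x))
    \<le> exponential_density (c (n - j)) x" .
  have "exp (- (exp (- x) / (1 - exp (- x)) / (1 - exp (- (\<gamma> * x / real n)))))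
      \<le> (\<Prod>i=1..n. 1 - exp (- (c i * x)))"
    unfolding c_def using assms n by (intro prod_one_minus_exp_ge) auto
  also have "\<dots> = (1 - exp (- (c (n - j) * x))) * (\<Prod>i\<in>{1..n} - {n - j}. 1 - exp (- (c i * x)))"
    using k by (intro prod.remove) auto
  also have "\<dots> \<le> 1 * (\<Prod>i\<in>{1..n} - {n - j}. 1 - exp (- (c i * x)))"
    using assms by (intro mult_right_mono prod_nonneg) (auto simp: c_def)
  finally have "exp (- (exp (- x) / (1 - exp (- x)) / (1 - exp (- (\<gamma> * x / real n)))))
      \<le> (\<Prod>i\<in>{1..n} - {n - j}. 1 - exp (- (c i * x)))" by simp
  then show ?thesis
    unfolding c_def[symmetric] by (intro mult_mono dens order_trans[OF _ dens]) auto
qed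

text \<open>
  Up to the vanishing correction \<open>1 - exp (- (t + centering \<gamma> n))\<close> in the denominator, this is
  a bound for the expected number of indices whose rescaled variable exceeds
  \<open>t + centering \<gamma> n\<close>. Its limit \<open>exp (- t)\<close> is the parameter of the limiting Poisson number of
  exceedances, which is why the maximum is Gumbel.
\<close>
lemma exceedance_bound_tendsto:
  fixes t \<gamma> :: real
  assumes "\<gamma> > 0"
  shows "(\<lambda>n. exp (- (t + centering \<gamma> n)) / (1 - exp (- (t + centering \<gamma> n)))
     / (1 - exp (- (\<gamma> * (t + centering \<gamma> n) / real n)))) \<longlonglongrightarrow> exp (- t)"
  using assms unfolding centering_def by real_asymp (simp add: exp_diff)

text \<open>
  Moving the winning index from \<open>n\<close> down by the fraction \<open>s / ln n\<close> increases its rate by a term of order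
  \<open>1 / ln n\<close>, which the centering, of order \<open>ln n\<close>, turns into the exponent \<open>\<gamma> s\<close> of the exponential limit law.
\<close>
lemma rate_excess_tendsto:
  fixes t \<gamma> s :: real
  assumes "\<gamma> > 0"
  shows "(\<lambda>n. ((1 / (1 - s / ln (real n))) powr \<gamma> - 1) * (t + centering \<gamma> n)) \<longlonglongrightarrow> \<gamma> * s"
  using assms unfolding centering_def by real_asymp

text \<open>
  The factor \<open>n / ln n\<close> is the reciprocal of the spacing of the rescaled index, so this is the
  passage from a probability per index to a density in \<open>s\<close>.
\<close>
lemma density_scale_tendsto:
  fixes t \<gamma> :: real
  assumes "\<gamma> > 0"
  shows "(\<lambda>n. real n / ln (real n) * exp (- (t + centering \<gamma> n))) \<longlonglongrightarrow> \<gamma> * exp (- t)"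
  using assms unfolding centering_def by real_asymp (simp add: exp_diff field_simps)

lemma filterlim_centering_at_top: "\<gamma> > 0 \<Longrightarrow> filterlim (centering \<gamma>) at_top sequentially"
  unfolding centering_def by real_asymp

text \<open>
  For \<open>s \<ge> 0\<close> a single summand carries the bound: the step \<open>j = \<lfloor>s / \<delta> n\<rfloor>\<close> that contains
  \<open>s\<close>, which is below \<open>n\<close> once \<open>s < ln n\<close>. Its density splits into the three factors whose limits are
  known.
\<close>
lemma liminf_density_ge:
  fixes \<gamma> t s :: real and \<phi> :: "real \<times> real \<Rightarrow> real"
  assumes \<gamma>: "0 < \<gamma>" and \<phi>: "continuous_on UNIV \<phi>" "\<And>z. 0 \<le> \<phi> z"
  defines "c \<equiv> \<lambda>n i. (real n / real i) powr \<gamma>" and "\<delta> \<equiv> \<lambda>n. ln (real n) / real n"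
  shows "ennreal (\<phi> (t, s)) * (ennreal (gumbel_density t) * ennreal (exponential_density \<gamma> s))
    \<le> liminf (\<lambda>n. \<Sum>j<n. (ennreal (\<phi> (t, real j * \<delta> n))
          * ennreal (exponential_density (c n (n - j)) (t + centering \<gamma> n)
            * (\<Prod>i\<in>{1..n} - {n - j}. 1 - exp (- (c n i * (t + centering \<gamma> n))))))
        * (ennreal (1 / \<delta> n) * indicator {real j * \<delta> n..<real (Suc j) * \<delta> n} s))"
    (is "_ \<le> liminf (\<lambda>n. \<Sum>j<n. ?h n j)")
proof (cases "0 \<le> s")
  case False
  then show ?thesis by (simp add: exponential_density_def)
next
  case s: True
  define x where "x n = t + centering \<gamma> n" for n
  define J where "J n = nat \<lfloor>s / \<delta> n\<rfloor>" for n
  define Q where "Q n = exp (- (exp (- x n) / (1 - exp (- x n)) / (1 - exp (- (\<gamma> * x n / real n)))))" for n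
  define R where "R n = exp (- (((1 / (1 - s / ln (real n))) powr \<gamma> - 1) * x n))" for n
  define r where "r n = \<phi> (t, real (J n) * \<delta> n) * (real n / ln (real n) * exp (- x n) * R n * Q n)" for n
  have ev_x: "eventually (\<lambda>n. 0 < x n) sequentially"
    using filterlim_at_top_dense[THEN iffD1, OF filterlim_centering_at_top[OF \<gamma>], rule_format, of "- t"]
    by eventually_elim (simp add: x_def)
  have ln_top: "filterlim (\<lambda>n. ln (real n)) at_top sequentially" by real_asymp
  have ev_s: "eventually (\<lambda>n. s < ln (real n)) sequentially"
    using ln_top by (simp add: filterlim_at_top_dense)
  have ev_n: "eventually (\<lambda>n. 2 \<le> n) sequentially" by (rule eventually_ge_at_top)
  have J: "real (J n) * \<delta> n \<le> s" "s < real (Suc (J n)) * \<delta> n" if "2 \<le> n" for n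
  proof -
    have \<delta>: "0 < \<delta> n" using that by (simp add: \<delta>_def)
    have "real (J n) = of_int \<lfloor>s / \<delta> n\<rfloor>" using s \<delta> by (simp add: J_def)
    then have "real (J n) \<le> s / \<delta> n" "s / \<delta> n < real (Suc (J n))"
      by linarith+
    then show "real (J n) * \<delta> n \<le> s" "s < real (Suc (J n)) * \<delta> n"
      using \<delta> by (simp_all add: field_simps del: of_nat_Suc)
  qed
  have "(\<lambda>n. real (J n) * \<delta> n) \<longlonglongrightarrow> s"
  proof (rule tendsto_sandwich)
    show "eventually (\<lambda>n. s - \<delta> n \<le> real (J n) * \<delta> n) sequentially"
      using ev_n by eventually_elim (use J(2) in \<open>force simp: algebra_simps\<close>)
    show "eventually (\<lambda>n. real (J n) * \<delta> n \<le> s) sequentially"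
      using ev_n by eventually_elim (rule J(1))
    show "(\<lambda>n. s - \<delta> n) \<longlonglongrightarrow> s" unfolding \<delta>_def by real_asymp
  qed auto
  then have lim_\<phi>: "(\<lambda>n. \<phi> (t, real (J n) * \<delta> n)) \<longlonglongrightarrow> \<phi> (t, s)"
    by (intro continuous_on_tendsto_compose[OF \<phi>(1)] tendsto_intros) auto
  have lim_x: "(\<lambda>n. real n / ln (real n) * exp (- x n)) \<longlonglongrightarrow> \<gamma> * exp (- t)"
    unfolding x_def by (rule density_scale_tendsto[OF \<gamma>])
  have lim_R: "R \<longlonglongrightarrow> exp (- (\<gamma> * s))"
    unfolding R_def x_def by (intro tendsto_exp tendsto_minus rate_excess_tendsto \<gamma>)
  have lim_Q: "Q \<longlonglongrightarrow> exp (- exp (- t))"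
    unfolding Q_def x_def by (intro tendsto_exp tendsto_minus exceedance_bound_tendsto \<gamma>)
  have "r \<longlonglongrightarrow> \<phi> (t, s) * (\<gamma> * exp (- t) * exp (- (\<gamma> * s)) * exp (- exp (- t)))"
    unfolding r_def by (rule tendsto_mult[OF lim_\<phi> tendsto_mult[OF tendsto_mult[OF lim_x lim_R] lim_Q]])
  also have "\<phi> (t, s) * (\<gamma> * exp (- t) * exp (- (\<gamma> * s)) * exp (- exp (- t)))
      = \<phi> (t, s) * (gumbel_density t * exponential_density \<gamma> s)"
    using s by (simp add: gumbel_density_def exponential_density_def mult_ac)
  finally have lim: "(\<lambda>n. ennreal (r n)) \<longlonglongrightarrow> ennreal (\<phi> (t, s) * (gumbel_density t * exponential_density \<gamma> s))"
    by (rule tendsto_ennrealI)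
  have "eventually (\<lambda>n. ennreal (r n) \<le> (\<Sum>j<n. ?h n j)) sequentially"
    using ev_x ev_s ev_n
  proof eventually_elim
    case (elim n)
    have \<delta>: "0 < \<delta> n" using elim by (simp add: \<delta>_def)
    have Jn: "real (J n) / real n \<le> s / ln (real n)" "s / ln (real n) < 1"
      using J(1)[OF elim(3)] elim s by (auto simp: \<delta>_def field_simps)
    then have "real (J n) / real n < 1" by linarith
    then have "J n < n" using elim by simp
    define w where "w = exponential_density (c n (n - J n)) (x n)
       * (\<Prod>i\<in>{1..n} - {n - J n}. 1 - exp (- (c n i * x n)))"
    have "exp (- x n) * R n * Q n \<le> w"
      unfolding w_def R_def Q_def c_def
      by (rule strict_max_density_ge[OF \<gamma> elim(1) \<open>J n < n\<close> Jn])
    then have "r n \<le> \<phi> (t, real (J n) * \<delta> n) * (1 / \<delta> n * w)"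
      unfolding r_def mult.assoc using \<phi>(2) \<delta> elim
      by (intro mult_left_mono) (auto simp: \<delta>_def intro: divide_right_mono mult_left_mono)
    moreover have "0 \<le> w" using \<open>exp (- x n) * R n * Q n \<le> w\<close>
      by (rule order_trans[rotated]) (simp add: R_def Q_def)
    ultimately have "ennreal (r n) \<le> ennreal (\<phi> (t, real (J n) * \<delta> n)) * ennreal w * ennreal (1 / \<delta> n)"
      using \<phi>(2) \<delta> by (simp add: ennreal_mult[symmetric] mult_ac ennreal_leI)
    also have "\<dots> = ?h n (J n)"
      using J[OF elim(3)] by (simp add: w_def x_def)
    also have "\<dots> \<le> (\<Sum>j<n. ?h n j)"
      using \<open>J n < n\<close> by (intro member_le_sum) auto
    finally show ?case .
  qed
  then have "liminf (\<lambda>n. ennreal (r n)) \<le> liminf (\<lambda>n. \<Sum>j<n. ?h n j)" by (rule Liminf_mono)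
  moreover have "liminf (\<lambda>n. ennreal (r n)) = ennreal (\<phi> (t, s) * (gumbel_density t * exponential_density \<gamma> s))"
    by (rule lim_imp_Liminf[OF _ lim]) simp
  ultimately show ?thesis
    using \<phi>(2) \<gamma> by (simp add: ennreal_mult gumbel_density_nonneg exponential_density_nonneg)
qed

section \<open>Passage to the limit\<close>

text \<open>
  Each index \<open>j\<close> is spread uniformly over a step of length \<open>\<delta>\<close>. This puts the discrete second coordinate
  on the same Lebesgue measure for every \<open>\<delta>\<close>, so that densities can be compared pointwise.
\<close>
lemma nn_integral_step_sum:
  fixes f :: "nat \<Rightarrow> real \<Rightarrow> ennreal"
  assumes f [measurable]: "\<And>j. f j \<in> borel_measurable borel" and \<delta>: "0 < \<delta>"
  shows "(\<integral>\<^sup>+(t, s). (\<Sum>j<n. f j t * (ennreal (1 / \<delta>) * indicator {real j * \<delta>..<real (Suc j) * \<delta>} s))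
      \<partial>(lborel \<Otimes>\<^sub>M lborel)) = (\<Sum>j<n. \<integral>\<^sup>+t. f j t \<partial>lborel)"
proof -
  have step: "(\<integral>\<^sup>+s. ennreal (1 / \<delta>) * indicator {real j * \<delta>..<real (Suc j) * \<delta>} s \<partial>lborel) = 1" for j
    using \<delta> by (subst nn_integral_cmult_indicator)
      (auto simp: emeasure_lborel_Ico algebra_simps ennreal_mult[symmetric])
  have "(\<integral>\<^sup>+(t, s). (\<Sum>j<n. f j t * (ennreal (1 / \<delta>) * indicator {real j * \<delta>..<real (Suc j) * \<delta>} s))
      \<partial>(lborel \<Otimes>\<^sub>M lborel))
     = (\<integral>\<^sup>+t. \<integral>\<^sup>+s. (\<Sum>j<n. f j t * (ennreal (1 / \<delta>) * indicator {real j * \<delta>..<real (Suc j) * \<delta>} s))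
      \<partial>lborel \<partial>lborel)"
    by (subst lborel.nn_integral_fst[symmetric]) auto
  also have "\<dots> = (\<integral>\<^sup>+t. (\<Sum>j<n. f j t) \<partial>lborel)"
    by (intro nn_integral_cong) (simp add: nn_integral_sum nn_integral_cmult step del: of_nat_Suc)
  also have "\<dots> = (\<Sum>j<n. \<integral>\<^sup>+t. f j t \<partial>lborel)" by (intro nn_integral_sum) auto
  finally show ?thesis .
qed

theorem proposition2p1:
  fixes M :: "'a measure" and X :: "nat \<Rightarrow> 'a \<Rightarrow> real" and \<gamma> :: real
    and N :: "'b measure" and G E :: "'b \<Rightarrow> real"
  assumes "\<gamma> > 0"
    and "prob_space M"
    and "prob_space.indep_vars M (\<lambda>_. borel) X {1..}"
    and "\<And>i. i \<ge> 1 \<Longrightarrow> distributed M lborel (X i) (exponential_density 1)"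
    and "prob_space N"
    and "gumbel_distributed N G"
    and "distributed N lborel E (exponential_density \<gamma>)"
    and "prob_space.indep_var N borel G borel E"
  shows "converges_in_distribution M
    (\<lambda>n \<omega>. (weighted_max \<gamma> X n \<omega> / real n powr \<gamma> - centering \<gamma> n,
            (real n - real (weighted_argmax \<gamma> X n \<omega>)) / real n * ln (real n)))
    N (\<lambda>\<omega>. (G \<omega>, E \<omega>))"
proof (rule converges_in_distributionI_liminf)
  interpret M: prob_space M by fact
  interpret N: prob_space N by fact
  have X [measurable]: "X i \<in> borel_measurable M" if "i \<in> {1..n}" for i n
    using assms(4)[of i] that by (simp add: distributed_def)
  have [measurable]: "weighted_max \<gamma> X n \<in> borel_measurable M" for n
    unfolding weighted_max_def by measurable
  have [measurable]: "weighted_argmax \<gamma> X n \<in> measurable M (count_space UNIV)" for n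
    unfolding weighted_argmax_def
  proof (rule measurable_Min_nat)
    fix i
    show "Measurable.pred M (\<lambda>\<omega>. i \<in> {1..n} \<and> real i powr \<gamma> * X i \<omega> = weighted_max \<gamma> X n \<omega>)"
      by (cases "i \<in> {1..n}") (use X[of i n] in simp_all)
  qed
  show "(\<lambda>\<omega>. (weighted_max \<gamma> X n \<omega> / real n powr \<gamma> - centering \<gamma> n,
            (real n - real (weighted_argmax \<gamma> X n \<omega>)) / real n * ln (real n))) \<in> borel_measurable M" for n
    by (subst borel_prod[symmetric]) measurable
  have G [measurable]: "G \<in> borel_measurable N" and E [measurable]: "E \<in> borel_measurable N"
    using assms(6,7) by (auto simp: gumbel_distributed_def distributed_def)
  show GE: "(\<lambda>\<omega>. (G \<omega>, E \<omega>)) \<in> borel_measurable N"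
    by (subst borel_prod[symmetric]) measurable

  have "distr N borel E = density lborel (exponential_density \<gamma>)"
    using distributed_distr_eq_density[OF assms(7)] by (metis distr_cong sets_lborel)
  then have joint: "distr N (borel \<Otimes>\<^sub>M borel) (\<lambda>\<omega>. (G \<omega>, E \<omega>)) = density (lborel \<Otimes>\<^sub>M lborel)
      (\<lambda>(t, s). ennreal (gumbel_density t) * ennreal (exponential_density \<gamma> s))"
    using assms(8) distr_gumbel[OF assms(5,6)] prob_space_exponential_density[OF assms(1)]
    by (subst pair_measure_density[symmetric])
      (auto simp: N.indep_var_distribution_eq prob_space_imp_sigma_finite lborel.sigma_finite_measure_axioms)

  fix \<phi> :: "real \<times> real \<Rightarrow> real"
  assume cont: "continuous_on UNIV \<phi>" and nonneg: "\<And>z. 0 \<le> \<phi> z"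
  have "\<phi> \<in> borel_measurable borel"
    using cont by (rule borel_measurable_continuous_onI)
  then have \<phi> [measurable]: "\<phi> \<in> borel_measurable (borel \<Otimes>\<^sub>M borel)" by (simp add: borel_prod)
  \<comment> \<open>The density of the first coordinate and the winning index, with the index \<open>n - j\<close> spread
    over the \<open>j\<close>-th step and the test function evaluated at the left end of the step.\<close>
  define \<delta> where "\<delta> n = ln (real n) / real n" for n
  define c where "c n i = (real n / real i) powr \<gamma>" for n i
  define w where "w n k t = exponential_density (c n k) (t + centering \<gamma> n)
       * (\<Prod>i\<in>{1..n} - {k}. 1 - exp (- (c n i * (t + centering \<gamma> n))))" for n k t
  have [measurable]: "w n k \<in> borel_measurable borel" for n k
    unfolding w_def by measurable
  define h where "h n = (\<lambda>(t, s). \<Sum>j<n. (ennreal (\<phi> (t, real j * \<delta> n)) * ennreal (w n (n - j) t))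
        * (ennreal (1 / \<delta> n) * indicator {real j * \<delta> n..<real (Suc j) * \<delta> n} s))" for n
  have h [measurable]: "h n \<in> borel_measurable (lborel \<Otimes>\<^sub>M lborel)" for n
    unfolding h_def by measurable

  have "(\<integral>\<^sup>+\<omega>. ennreal (\<phi> (G \<omega>, E \<omega>)) \<partial>N)
      = (\<integral>\<^sup>+z. ennreal (\<phi> z) \<partial>distr N (borel \<Otimes>\<^sub>M borel) (\<lambda>\<omega>. (G \<omega>, E \<omega>)))"
    by (subst nn_integral_distr) auto
  also have "\<dots> = (\<integral>\<^sup>+(t, s). ennreal (\<phi> (t, s)) * (ennreal (gumbel_density t) * ennreal (exponential_density \<gamma> s))
      \<partial>(lborel \<Otimes>\<^sub>M lborel))"
    unfolding joint by (subst nn_integral_density) (auto intro!: nn_integral_cong simp: mult_ac)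
  also have "\<dots> \<le> (\<integral>\<^sup>+z. liminf (\<lambda>n. h n z) \<partial>(lborel \<Otimes>\<^sub>M lborel))"
    using liminf_density_ge[OF assms(1) cont nonneg]
    by (intro nn_integral_mono) (auto simp: h_def w_def c_def \<delta>_def)
  also have "\<dots> \<le> liminf (\<lambda>n. \<integral>\<^sup>+z. h n z \<partial>(lborel \<Otimes>\<^sub>M lborel))"
    by (rule nn_integral_liminf) measurable
  also have "\<dots> \<le> liminf (\<lambda>n. \<integral>\<^sup>+\<omega>. ennreal (\<phi> (weighted_max \<gamma> X n \<omega> / real n powr \<gamma> - centering \<gamma> n,
            (real n - real (weighted_argmax \<gamma> X n \<omega>)) / real n * ln (real n))) \<partial>M)"
  proof (rule Liminf_mono, rule eventually_mono[OF eventually_ge_at_top[of 2]])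
    fix n :: nat assume n: "2 \<le> n"
    then have \<delta>: "0 < \<delta> n" by (simp add: \<delta>_def)
    have "(\<integral>\<^sup>+z. h n z \<partial>(lborel \<Otimes>\<^sub>M lborel))
        = (\<Sum>j<n. \<integral>\<^sup>+t. ennreal (\<phi> (t, real j * \<delta> n)) * ennreal (w n (n - j) t) \<partial>lborel)"
      unfolding h_def by (rule nn_integral_step_sum[OF _ \<delta>]) measurable
    also have "\<dots> = (\<Sum>k=1..n. \<integral>\<^sup>+t. ennreal (\<phi> (t, (real n - real k) / real n * ln (real n)))
        * ennreal (w n k t) \<partial>lborel)"
      by (rule sum.reindex_bij_witness[of _ "\<lambda>k. n - k" "\<lambda>j. n - j"]) (auto simp: of_nat_diff \<delta>_def)
    also have "\<dots> \<le> (\<integral>\<^sup>+\<omega>. ennreal (\<phi> (weighted_max \<gamma> X n \<omega> / real n powr \<gamma> - centering \<gamma> n,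
            (real n - real (weighted_argmax \<gamma> X n \<omega>)) / real n * ln (real n))) \<partial>M)"
      unfolding w_def c_def by (rule M.weighted_max_nn_integral_ge[OF assms(3,4)]) measurable
    finally show "(\<integral>\<^sup>+z. h n z \<partial>(lborel \<Otimes>\<^sub>M lborel))
      \<le> (\<integral>\<^sup>+\<omega>. ennreal (\<phi> (weighted_max \<gamma> X n \<omega> / real n powr \<gamma> - centering \<gamma> n,
            (real n - real (weighted_argmax \<gamma> X n \<omega>)) / real n * ln (real n))) \<partial>M)" .
  qed
  finally show "(\<integral>\<^sup>+\<omega>. ennreal (\<phi> (G \<omega>, E \<omega>)) \<partial>N)
    \<le> liminf (\<lambda>n. \<integral>\<^sup>+\<omega>. ennreal (\<phi> (weighted_max \<gamma> X n \<omega> / real n powr \<gamma> - centering \<gamma> n,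
            (real n - real (weighted_argmax \<gamma> X n \<omega>)) / real n * ln (real n))) \<partial>M)" .
qed fact+

end
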